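(* Let $f:V\to\mathbb{R}$ be a feature location, let $g^{(0)}:V\to\mathbb{C}$ be normalized (i.e. $\|g^{(0)}\|_2=1$) and let $g^{(t)}=\mathcal{S}[t,f]g^{(0)}$, where $\mathcal{S}[t,f]=e^{-it\Delta_f}$ and $\Delta_f=-\nabla_f^2$. If $g^{(t)}$ is $\epsilon$-$f$ regular, then $$\left|\frac{\partial}{\partial t}\mathcal{E}_{X_f}(g^{(t)})-2\,\mathcal{E}_{i\nabla_f}(g^{(0)})\right|\le 2\epsilon\,\|\nabla_f\|_{\mathrm{op}}.$$
   Context: $\mathcal{G}=(V,E)$ is a finite undirected weighted graph with $V=[N]=\{1,\dots,N\}$, $E\subset[N]^2$, and real symmetric adjacency matrix $A=(a_{n,m})\in\mathbb{R}^{N\times N}$ with $a_{n,m}=0$ whenever $n,m$ are not joined by an edge; $\mathcal{N}(v)$ is the neighborhood of $v$. Signals $g:V\to\mathbb{C}$ are identified with vectors in $\mathbb{C}^N$, with $\langle u,g\rangle=\sum_{v\in V}u(v)\overline{g(v)}$ and $\|g\|_2^2=\langle g,g\rangle$; $\|M\|_{\mathrm{op}}=\sup_{\|x\|_2=1}\|Mx\|_2$. The $f$-partial derivative $\nabla_f\in\mathbb{C}^{N\times N}$ has entries $(\nabla_f)_{n,m}=a_{n,m}(f(n)-f(m))$. The location observable is $X_f=\mathrm{diag}(f)$. The $f$-smoothing operator is $(W_fg)(v)=\sum_{w\in\mathcal{N}(v)}a_{v,w}(f(w)-f(v))^2g(w)$. For a self-adjoint operator $M$ and a normalized signal $g$,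 $\mathcal{E}_M(g)=\langle Mg,g\rangle$. A signal $g:V\to\mathbb{C}$ is called $\epsilon$-$f$ regular if there exists a signal $e_g:V\to\mathbb{C}$ such that $W_fg=g+e_g$ with $\|e_g\|_2\le\epsilon$. *)

theory Defs
  imports "HOL-Analysis.Analysis"
begin

text \<open>
  The vertex set is the finite type \<open>'n\<close>, and a signal \<open>g : V \<rightarrow> \<complex>\<close> is a vector of type
  \<open>complex ^ 'n\<close>, whose library norm is the 2-norm.  The library inner product on this type is
  real-valued, hence the separate sesquilinear one below.
\<close>

definition weighted_graph :: "('n \<times> 'n) set \<Rightarrow> real ^ 'n ^ 'n \<Rightarrow> bool" where
  "weighted_graph E A \<longleftrightarrow>
     sym E \<and> transpose A = A \<and> (\<forall>n m. (n, m) \<notin> E \<longrightarrow> A $ n $ m = 0)"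

definition neighborhood :: "('n \<times> 'n) set \<Rightarrow> 'n \<Rightarrow> 'n set" where
  "neighborhood E v = {w. (v, w) \<in> E}"

definition cdot :: "complex ^ 'n \<Rightarrow> complex ^ 'n \<Rightarrow> complex" where
  "cdot u g = (\<Sum>v\<in>UNIV. u $ v * cnj (g $ v))"

definition matrix_scale :: "complex \<Rightarrow> complex ^ 'n ^ 'n \<Rightarrow> complex ^ 'n ^ 'n" where
  "matrix_scale c M = (\<chi> n m. c * M $ n $ m)"

text \<open>
  The operations \<open>*\<close>, \<open>1\<close> and \<open>^\<close> on the vector types act componentwise, so powers and the
  exponential have to be built from the matrix product \<open>**\<close> and the identity \<open>mat 1\<close>.
\<close>

primrec matrix_pow :: "complex ^ 'n ^ 'n \<Rightarrow> nat \<Rightarrow> complex ^ 'n ^ 'n" where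
  "matrix_pow M 0 = mat 1"
| "matrix_pow M (Suc k) = M ** matrix_pow M k"

definition matrix_exp :: "complex ^ 'n ^ 'n \<Rightarrow> complex ^ 'n ^ 'n" where
  "matrix_exp M = (\<Sum>k. matrix_pow M k /\<^sub>R fact k)"

definition nabla :: "real ^ 'n ^ 'n \<Rightarrow> ('n \<Rightarrow> real) \<Rightarrow> complex ^ 'n ^ 'n" where
  "nabla A f = (\<chi> n m. complex_of_real (A $ n $ m * (f n - f m)))"

definition laplacian :: "real ^ 'n ^ 'n \<Rightarrow> ('n \<Rightarrow> real) \<Rightarrow> complex ^ 'n ^ 'n" where
  "laplacian A f = - (nabla A f ** nabla A f)"

definition shift :: "real ^ 'n ^ 'n \<Rightarrow> real \<Rightarrow> ('n \<Rightarrow> real) \<Rightarrow> complex ^ 'n ^ 'n" where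
  "shift A t f = matrix_exp (matrix_scale (- \<i> * complex_of_real t) (laplacian A f))"

definition location :: "('n \<Rightarrow> real) \<Rightarrow> complex ^ 'n ^ 'n" where
  "location f = (\<chi> n m. if n = m then complex_of_real (f n) else 0)"

definition smoothing ::
  "('n \<times> 'n) set \<Rightarrow> real ^ 'n ^ 'n \<Rightarrow> ('n \<Rightarrow> real) \<Rightarrow> complex ^ 'n \<Rightarrow> complex ^ 'n" where
  "smoothing E A f g =
     (\<chi> v. \<Sum>w\<in>neighborhood E v. complex_of_real (A $ v $ w * (f w - f v)\<^sup>2) * g $ w)"

text \<open>Complex-valued for arbitrary \<open>M\<close>; the values are real when \<open>M\<close> is self-adjoint.\<close>

definition expect :: "complex ^ 'n ^ 'n \<Rightarrow> complex ^ 'n \<Rightarrow> complex" where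
  "expect M g = cdot (M *v g) g"

definition regular_signal ::
  "('n \<times> 'n) set \<Rightarrow> real ^ 'n ^ 'n \<Rightarrow> real \<Rightarrow> ('n \<Rightarrow> real) \<Rightarrow> complex ^ 'n \<Rightarrow> bool" where
  "regular_signal E A \<epsilon> f g \<longleftrightarrow> (\<exists>e. smoothing E A f g = g + e \<and> norm e \<le> \<epsilon>)"

end

theory Submission
  imports Defs
begin

text \<open>
  Write \<open>D\<close> for \<open>\<nabla>\<^sub>f\<close>, \<open>X\<close> for \<open>X\<^sub>f\<close> and \<open>W\<close> for \<open>W\<^sub>f\<close>.  Entrywise \<open>[X, D] = W\<close>, so \<open>[X, D\<^sup>2] = W D + D W\<close>, and
  by Ehrenfest's theorem the derivative of \<open>\<E>\<^sub>X(g)\<close> is \<open>i \<langle>(W D + D W) g, g\<rangle>\<close>.  As \<open>W\<close> is self-adjoint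
  and \<open>D\<close> skew-adjoint, this equals \<open>i (\<langle>D g, W g\<rangle> - \<langle>W g, D g\<rangle>)\<close>.  Substituting \<open>W g = g + e\<close> gives
  \<open>2 \<E>\<^bsub>iD\<^esub>(g)\<close>, which is conserved because \<open>D\<close> commutes with \<open>D\<^sup>2\<close>, plus an error that Cauchy-Schwarz
  bounds by \<open>2 \<parallel>D\<parallel> \<parallel>e\<parallel>\<close>, the norm of \<open>g\<close> being conserved as well.
\<close>

section \<open>The matrix exponential, entry by entry as a power series\<close>

lemma matrix_pow_scale_nth:
  "matrix_pow (matrix_scale c M) k $ i $ j = c ^ k * matrix_pow M k $ i $ j"
  by (induction k arbitrary: i)
    (simp_all add: matrix_scale_def matrix_matrix_mult_def sum_distrib_left mult_ac)

text \<open>Each row sum of \<open>M\<close> is one summand of the total, so every further factor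
  \<open>M\<close> costs at most one factor of the total. The crude bound suffices for comparison
  with the exponential series.\<close>

lemma norm_matrix_pow_nth_le:
  fixes M :: "complex ^ 'n ^ 'n::finite"
  shows "norm (matrix_pow M k $ i $ j) \<le> (\<Sum>i\<in>UNIV. \<Sum>j\<in>UNIV. norm (M $ i $ j)) ^ k"
proof (induction k arbitrary: i)
  case 0
  then show ?case by (simp add: mat_def)
next
  case (Suc k)
  let ?B = "\<Sum>i\<in>UNIV. \<Sum>j\<in>UNIV. norm (M $ i $ j)"
  have "norm (matrix_pow M (Suc k) $ i $ j) \<le> (\<Sum>l\<in>UNIV. norm (M $ i $ l) * norm (matrix_pow M k $ l $ j))"
    by (simp add: matrix_matrix_mult_def sum_norm_le norm_mult)
  also have "\<dots> \<le> (\<Sum>l\<in>UNIV. norm (M $ i $ l) * ?B ^ k)"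
    by (intro sum_mono mult_left_mono Suc.IH) auto
  also have "\<dots> = (\<Sum>l\<in>UNIV. norm (M $ i $ l)) * ?B ^ k"
    by (simp add: sum_distrib_right)
  also have "\<dots> \<le> ?B * ?B ^ k"
    by (intro mult_right_mono member_le_sum[where f = "\<lambda>i. \<Sum>j\<in>UNIV. norm (M $ i $ j)"])
      (auto intro!: sum_nonneg zero_le_power)
  finally show ?case by simp
qed

lemma summable_matrix_pow_nth:
  fixes M :: "complex ^ 'n ^ 'n::finite"
  shows "summable (\<lambda>k. matrix_pow M k $ i $ j / fact k * z ^ k)"
proof (rule summable_comparison_test')
  let ?B = "\<Sum>i\<in>UNIV. \<Sum>j\<in>UNIV. norm (M $ i $ j)"
  show "summable (\<lambda>k. inverse (fact k) * (?B * norm z) ^ k)"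
    by (rule summable_exp)
  show "norm (matrix_pow M k $ i $ j / fact k * z ^ k) \<le> inverse (fact k) * (?B * norm z) ^ k" for k
    using mult_right_mono[OF norm_matrix_pow_nth_le[of M k i j], of "norm z ^ k / fact k"]
    by (simp add: norm_mult norm_divide norm_power power_mult_distrib field_simps)
qed

text \<open>Convergence of matrices is componentwise, so each entry becomes an ordinary power series
  in \<open>z\<close>, open to termwise differentiation.\<close>

lemma matrix_exp_scale_nth:
  fixes M :: "complex ^ 'n ^ 'n::finite"
  shows "matrix_exp (matrix_scale z M) $ i $ j = (\<Sum>k. matrix_pow M k $ i $ j / fact k * z ^ k)"
proof -
  have "(\<lambda>k. matrix_pow (matrix_scale z M) k /\<^sub>R fact k) sums
      (\<chi> i j. \<Sum>k. matrix_pow M k $ i $ j / fact k * z ^ k)"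
    unfolding sums_def
  proof (intro vec_tendstoI)
    fix i j
    show "(\<lambda>n. (\<Sum>k<n. matrix_pow (matrix_scale z M) k /\<^sub>R fact k) $ i $ j)
      \<longlonglongrightarrow> (\<chi> i j. \<Sum>k. matrix_pow M k $ i $ j / fact k * z ^ k) $ i $ j"
      using summable_LIMSEQ[OF summable_matrix_pow_nth[of M i j z]]
      by (simp add: matrix_pow_scale_nth scaleR_conv_of_real[where 'a = complex] field_simps)
  qed
  then show ?thesis
    by (simp add: matrix_exp_def sums_unique[symmetric])
qed

lemma matrix_exp_scale_0:
  fixes M :: "complex ^ 'n ^ 'n::finite"
  shows "matrix_exp (matrix_scale 0 M) = mat 1"
  unfolding vec_eq_iff matrix_exp_scale_nth powser_zero by simp

lemma has_field_derivative_matrix_exp_nth: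
  fixes M :: "complex ^ 'n ^ 'n::finite"
  shows "((\<lambda>z. matrix_exp (matrix_scale z M) $ i $ j) has_field_derivative
    (M ** matrix_exp (matrix_scale z M)) $ i $ j) (at z)"
proof -
  define c where "c i k = matrix_pow M k $ i $ j / fact k" for i k
  \<comment> \<open>The factor \<open>k + 1\<close> from \<open>diffs\<close> cancels against
    \<open>fact (k + 1)\<close>, leaving \<open>M ** matrix_pow M k\<close>; expanding this product
    keeps column \<open>j\<close> and lets the row vary, hence \<open>c\<close> has the row as
    argument.\<close>
  have *: "diffs (c i) k * z ^ k = (\<Sum>l\<in>UNIV. M $ i $ l * (c l k * z ^ k))" for k
    by (simp add: diffs_def c_def matrix_matrix_mult_def field_simps sum_distrib_left
        sum_divide_distrib del: of_nat_Suc)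
  have "((\<lambda>z. \<Sum>k. c i k * z ^ k) has_field_derivative (\<Sum>k. diffs (c i) k * z ^ k)) (at z)"
    by (rule termdiffs_strong_converges_everywhere) (unfold c_def, rule summable_matrix_pow_nth)
  also have "(\<Sum>k. diffs (c i) k * z ^ k) = (\<Sum>l\<in>UNIV. M $ i $ l * (\<Sum>k. c l k * z ^ k))"
  proof -
    have "summable (\<lambda>k. c l k * z ^ k)" for l
      unfolding c_def by (rule summable_matrix_pow_nth)
    then show ?thesis
      unfolding * by (subst suminf_sum) (simp_all add: suminf_mult summable_mult)
  qed
  finally show ?thesis
    by (simp add: matrix_exp_scale_nth c_def matrix_matrix_mult_def)
qed

section \<open>Sesquilinearity and Cauchy-Schwarz\<close>

lemma cdot_add_left: "cdot (x + y) z = cdot x z + cdot y z"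
  by (simp add: cdot_def distrib_right sum.distrib)

lemma cdot_add_right: "cdot x (y + z) = cdot x y + cdot x z"
  by (simp add: cdot_def distrib_left sum.distrib)

lemma cdot_diff_left: "cdot (x - y) z = cdot x z - cdot y z"
  by (simp add: cdot_def left_diff_distrib sum_subtractf)

lemma cdot_diff_right: "cdot x (y - z) = cdot x y - cdot x z"
  by (simp add: cdot_def right_diff_distrib sum_subtractf)

lemma cdot_minus_left: "cdot (- x) y = - cdot x y"
  by (simp add: cdot_def sum_negf)

lemma cdot_minus_right: "cdot x (- y) = - cdot x y"
  by (simp add: cdot_def sum_negf)

lemma matrix_vector_mult_minus_left:
  "(- M) *v x = - (M *v x)" for M :: "'a::ring_1 ^ 'n ^ 'm"
  by (simp add: vec_eq_iff matrix_vector_mult_def sum_negf)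

lemma matrix_vector_mult_minus_right:
  "M *v (- x) = - (M *v x)" for M :: "'a::ring_1 ^ 'n ^ 'm"
  by (simp add: vec_eq_iff matrix_vector_mult_def sum_negf)

lemma cdot_scale_left: "cdot (c *s x) y = c * cdot x y"
  by (simp add: cdot_def sum_distrib_left mult_ac)

lemma cdot_scale_right: "cdot x (c *s y) = cnj c * cdot x y"
  by (simp add: cdot_def sum_distrib_left mult_ac)

lemma cdot_self: "cdot x x = of_real ((norm x)\<^sup>2)"
proof -
  have "(norm x)\<^sup>2 = (\<Sum>v\<in>UNIV. (norm (x $ v))\<^sup>2)"
    by (simp add: norm_vec_def L2_set_def sum_nonneg)
  then show ?thesis
    by (simp only: cdot_def of_real_sum complex_norm_square)
qed

lemma cmod_cdot_le: "cmod (cdot x y) \<le> norm x * norm y"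
proof -
  have "cmod (cdot x y) \<le> (\<Sum>v\<in>UNIV. \<bar>norm (x $ v)\<bar> * \<bar>norm (y $ v)\<bar>)"
    by (simp add: cdot_def sum_norm_le norm_mult)
  also have "\<dots> \<le> norm x * norm y"
    unfolding norm_vec_def by (rule L2_set_mult_ineq)
  finally show ?thesis .
qed

lemma norm_matrix_vector_le_onorm:
  fixes M :: "complex ^ 'n ^ 'm::finite"
  shows "norm (M *v x) \<le> onorm (\<lambda>x. M *v x) * norm x"
  by (rule onorm) (rule matrix_vector_mul_bounded_linear)

section \<open>Ehrenfest's theorem and conservation laws\<close>

lemma has_vector_derivative_cdot:
  assumes "\<And>v. ((\<lambda>s. x s $ v) has_vector_derivative x' $ v) (at t)"
    and "\<And>v. ((\<lambda>s. y s $ v) has_vector_derivative y' $ v) (at t)"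
  shows "((\<lambda>s. cdot (x s) (y s)) has_vector_derivative cdot x' (y t) + cdot (x t) y') (at t)"
proof -
  have "((\<lambda>s. \<Sum>v\<in>UNIV. x s $ v * cnj (y s $ v)) has_vector_derivative
      (\<Sum>v\<in>UNIV. x t $ v * cnj (y' $ v) + x' $ v * cnj (y t $ v))) (at t)"
    by (intro has_vector_derivative_sum has_vector_derivative_mult
        has_vector_derivative_cnj assms)
  then show ?thesis
    by (simp add: cdot_def sum.distrib add.commute)
qed

lemma has_vector_derivative_matrix_vector_nth:
  fixes M :: "complex ^ 'n ^ 'm::finite"
  assumes "\<And>v. ((\<lambda>s. x s $ v) has_vector_derivative x' $ v) (at t)"
  shows "((\<lambda>s. (M *v x s) $ v) has_vector_derivative (M *v x') $ v) (at t)"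
  unfolding matrix_vector_mult_def
  by (auto intro!: has_vector_derivative_sum has_vector_derivative_mult_right assms)

text \<open>The solution of \<open>x' = - \<i> H x\<close> with initial value \<open>x\<close>, for
  a general \<open>H\<close>, so that the conservation laws are independent of the graph.\<close>

definition schroedinger :: "complex ^ 'n ^ 'n \<Rightarrow> complex ^ 'n \<Rightarrow> real \<Rightarrow> complex ^ 'n" where
  "schroedinger H x s = matrix_exp (matrix_scale (- \<i> * of_real s) H) *v x"

lemma schroedinger_0: "schroedinger H (x :: complex ^ 'n::finite) 0 = x"
  by (simp add: schroedinger_def matrix_exp_scale_0)

lemma has_vector_derivative_schroedinger_nth:
  fixes H :: "complex ^ 'n ^ 'n::finite"
  shows "((\<lambda>s. schroedinger H x s $ v) has_vector_derivative
    (- \<i> *s (H *v schroedinger H x s)) $ v) (at s)"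
proof -
  let ?U = "\<lambda>s. matrix_exp (matrix_scale (- \<i> * of_real s) H)"
  have "((\<lambda>s. - \<i> * complex_of_real s) has_vector_derivative - \<i>) (at s)"
    by (auto intro!: derivative_eq_intros)
  \<comment> \<open>The complex derivative in \<open>z\<close> is restricted to the line
    \<open>z = - \<i> s\<close>.\<close>
  from field_vector_diff_chain_at[OF this has_field_derivative_matrix_exp_nth]
  have "((\<lambda>s. ?U s $ v $ w) has_vector_derivative - \<i> * (H ** ?U s) $ v $ w) (at s)" for w
    by (simp add: o_def)
  then have "((\<lambda>s. \<Sum>w\<in>UNIV. ?U s $ v $ w * x $ w) has_vector_derivative
      (\<Sum>w\<in>UNIV. (- \<i> * (H ** ?U s) $ v $ w) * x $ w)) (at s)"
    by (intro has_vector_derivative_sum has_vector_derivative_mult_left)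
  then show ?thesis
    by (simp add: schroedinger_def matrix_vector_mul_assoc)
      (simp add: matrix_vector_mult_def sum_distrib_left mult.assoc sum_negf)
qed

text \<open>In the product rule the second \<open>- \<i>\<close> leaves \<open>cdot\<close>
  conjugated, and self-adjointness moves the second \<open>H\<close> to the left; the two terms then
  form a commutator.\<close>

lemma ehrenfest_has_vector_derivative:
  fixes H M :: "complex ^ 'n ^ 'n::finite"
  assumes H: "\<And>x y. cdot (H *v x) y = cdot x (H *v y)"
  shows "((\<lambda>s. expect M (schroedinger H x s)) has_vector_derivative
    - \<i> * expect (M ** H - H ** M) (schroedinger H x s)) (at s)"
proof -
  let ?g = "schroedinger H x"
  have "((\<lambda>s. expect M (?g s)) has_vector_derivative
      cdot (M *v (- \<i> *s (H *v ?g s))) (?g s) + cdot (M *v ?g s) (- \<i> *s (H *v ?g s))) (at s)"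
    unfolding expect_def
    by (intro has_vector_derivative_cdot has_vector_derivative_matrix_vector_nth
        has_vector_derivative_schroedinger_nth)
  also have "cdot (M *v (- \<i> *s (H *v ?g s))) (?g s) + cdot (M *v ?g s) (- \<i> *s (H *v ?g s))
      = - \<i> * expect (M ** H - H ** M) (?g s)"
    by (simp add: expect_def matrix_vector_mult_diff_rdistrib cdot_diff_left
        matrix_vector_mult_minus_right cdot_minus_left cdot_minus_right
        vector_scalar_commute cdot_scale_left cdot_scale_right H[symmetric]
        matrix_vector_mul_assoc[symmetric] right_diff_distrib)
  finally show ?thesis .
qed

lemma expect_schroedinger_commuting:
  fixes H M :: "complex ^ 'n ^ 'n::finite"
  assumes H: "\<And>x y. cdot (H *v x) y = cdot x (H *v y)"
    and MH: "M ** H = H ** M"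
  shows "expect M (schroedinger H x s) = expect M x"
proof -
  have "((\<lambda>s. expect M (schroedinger H x s)) has_vector_derivative 0) (at s)" for s
    using ehrenfest_has_vector_derivative[OF H, of M x s]
    by (simp add: MH expect_def cdot_def)
  then obtain c where "expect M (schroedinger H x s) = c" for s
    using has_vector_derivative_zero_constant[of UNIV "\<lambda>s. expect M (schroedinger H x s)"]
    by auto
  from this[of s] this[of 0] show ?thesis
    by (simp add: schroedinger_0)
qed

text \<open>The squared norm is the expectation of the identity, which commutes with
  \<open>H\<close>.\<close>

lemma norm_schroedinger:
  fixes H :: "complex ^ 'n ^ 'n::finite"
  assumes "\<And>x y. cdot (H *v x) y = cdot x (H *v y)"
  shows "norm (schroedinger H x s) = norm x"
proof -
  have "expect (mat 1) (schroedinger H x s) = expect (mat 1) x"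
    by (rule expect_schroedinger_commuting[OF assms]) simp
  then show ?thesis
    by (simp add: expect_def cdot_self flip: of_real_power)
qed

section \<open>The operators of the graph\<close>

lemma shift_eq_schroedinger: "shift A s f *v x = schroedinger (laplacian A f) x s"
  by (simp add: shift_def schroedinger_def)

text \<open>The entries are real, and antisymmetric as products of a symmetric weight and a
  difference of \<open>f\<close>.\<close>

lemma cdot_nabla:
  assumes "weighted_graph E A"
  shows "cdot (nabla A f *v x) y = - cdot x (nabla A f *v y)"
proof -
  have "transpose A = A"
    using assms by (simp add: weighted_graph_def)
  then have sym: "A $ v $ w = A $ w $ v" for v w
    by (simp add: transpose_def vec_eq_iff)
  have "cdot (nabla A f *v x) y = (\<Sum>v\<in>UNIV. \<Sum>w\<in>UNIV. nabla A f $ v $ w * x $ w * cnj (y $ v))"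
    by (simp add: cdot_def matrix_vector_mult_def sum_distrib_right)
  also have "\<dots> = (\<Sum>w\<in>UNIV. \<Sum>v\<in>UNIV. nabla A f $ v $ w * x $ w * cnj (y $ v))"
    by (rule sum.swap)
  also have "\<dots> = (\<Sum>w\<in>UNIV. \<Sum>v\<in>UNIV. - (x $ w * cnj (nabla A f $ w $ v * y $ v)))"
    by (intro sum.cong refl) (simp add: nabla_def sym algebra_simps)
  also have "\<dots> = - cdot x (nabla A f *v y)"
    by (simp add: cdot_def matrix_vector_mult_def sum_distrib_left sum_negf)
  finally show ?thesis .
qed

lemma laplacian_vector: "laplacian A f *v x = - (nabla A f *v (nabla A f *v x))"
  by (simp add: laplacian_def matrix_vector_mult_minus_left matrix_vector_mul_assoc)

lemma cdot_laplacian: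
  assumes "weighted_graph E A"
  shows "cdot (laplacian A f *v x) y = cdot x (laplacian A f *v y)"
  by (simp add: laplacian_vector cdot_minus_left cdot_minus_right cdot_nabla[OF assms])

lemma location_vector_nth: "(location f *v x) $ v = of_real (f v) * x $ v"
  by (simp add: location_def matrix_vector_mult_def if_distrib[of "\<lambda>a. a * _"] sum.delta cong: if_cong)

text \<open>Commuting with the diagonal matrix multiplies entry \<open>(v, w)\<close> by
  \<open>f v - f w\<close>, a factor that \<open>nabla\<close> already carries once; hence the
  square.\<close>

lemma smoothing_eq_commutator:
  assumes "weighted_graph E A"
  shows "smoothing E A f x = location f *v (nabla A f *v x) - nabla A f *v (location f *v x)"
proof -
  have "smoothing E A f x $ v = (location f *v (nabla A f *v x) - nabla A f *v (location f *v x)) $ v" for v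
  proof -
    have "smoothing E A f x $ v
        = (\<Sum>w\<in>UNIV. complex_of_real (A $ v $ w * (f w - f v)\<^sup>2) * x $ w)"
      unfolding smoothing_def vec_lambda_beta
      \<comment> \<open>Vertices outside the neighborhood contribute zero, as the weights vanish off
        the edges.\<close>
      by (rule sum.mono_neutral_left) (use assms in \<open>auto simp: neighborhood_def weighted_graph_def\<close>)
    also have "\<dots> = (\<Sum>w\<in>UNIV. of_real (f v) * (nabla A f $ v $ w * x $ w)
        - nabla A f $ v $ w * (of_real (f w) * x $ w))"
      by (intro sum.cong refl) (simp add: nabla_def power2_eq_square algebra_simps)
    finally show ?thesis
      by (simp add: location_vector_nth matrix_vector_mult_def[of "nabla A f"] sum_subtractf sum_distrib_left)
  qed
  then show ?thesis by (simp add: vec_eq_iff)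
qed

theorem theorem18:
  fixes E :: "('n::finite \<times> 'n) set"
    and A :: "real ^ 'n ^ 'n"
    and f :: "'n \<Rightarrow> real"
    and g0 :: "complex ^ 'n"
    and g :: "real \<Rightarrow> complex ^ 'n"
    and t \<epsilon> :: real
  assumes "weighted_graph E A"
    and "norm g0 = 1"
    and "\<And>s. g s = shift A s f *v g0"
    and "regular_signal E A \<epsilon> f (g t)"
  shows "(\<lambda>s. expect (location f) (g s)) differentiable (at t) \<and>
    cmod (vector_derivative (\<lambda>s. expect (location f) (g s)) (at t)
            - 2 * expect (matrix_scale \<i> (nabla A f)) g0)
      \<le> 2 * \<epsilon> * onorm (\<lambda>x. nabla A f *v x)"
proof -
  let ?D = "nabla A f" and ?X = "location f" and ?L = "laplacian A f" and ?W = "smoothing E A f"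
  note D = cdot_nabla[OF assms(1)] and L = cdot_laplacian[OF assms(1)]
  have g: "g s = schroedinger ?L g0 s" for s
    by (simp add: assms(3) shift_eq_schroedinger)
  obtain e where e: "?W (g t) = g t + e" "norm e \<le> \<epsilon>"
    using assms(4) by (auto simp: regular_signal_def)

  have deriv: "((\<lambda>s. expect ?X (g s)) has_vector_derivative
      - \<i> * expect (?X ** ?L - ?L ** ?X) (g t)) (at t)"
    unfolding g by (rule ehrenfest_has_vector_derivative[OF L])

  \<comment> \<open>Add and subtract \<open>?D ?X ?D\<close> in the commutator of \<open>?X\<close>
    with the square of \<open>?D\<close>; the outer sign is that of the Laplacian.\<close>
  have commutator: "(?X ** ?L - ?L ** ?X) *v g t = - (?W (?D *v g t) + ?D *v ?W (g t))"
    by (simp add: smoothing_eq_commutator[OF assms(1)] matrix_vector_mult_diff_rdistrib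
        matrix_vector_mult_diff_distrib matrix_vector_mul_assoc[symmetric] laplacian_vector
        matrix_vector_mult_minus_right)
  have W: "cdot (?W x) y = cdot x (?W y)" for x y :: "complex ^ 'n"
  proof -
    have "cdot (?X *v x) y = cdot x (?X *v y)" for x y :: "complex ^ 'n"
      by (simp add: cdot_def location_vector_nth mult_ac)
    then show ?thesis
      by (simp add: smoothing_eq_commutator[OF assms(1)] cdot_diff_left cdot_diff_right D)
  qed
  \<comment> \<open>\<open>?W\<close> and the outer \<open>?D\<close> are moved to the right
    argument, the latter with a change of sign, so that only \<open>?W (g t)\<close> occurs and
    regularity applies.\<close>
  have "- \<i> * expect (?X ** ?L - ?L ** ?X) (g t)
      = \<i> * (cdot (?D *v g t) (g t + e) - cdot (g t + e) (?D *v g t))"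
    unfolding expect_def commutator
    by (simp add: cdot_minus_left cdot_diff_left cdot_add_left D e(1) W)
      (simp add: algebra_simps)
  \<comment> \<open>Skew-adjointness turns \<open>- cdot (g t) (?D *v g t)\<close> into a second
    copy of \<open>expect ?D (g t)\<close>.\<close>
  also have "\<dots> = 2 * \<i> * expect ?D (g t) + \<i> * (cdot (?D *v g t) e - cdot e (?D *v g t))"
    using D[of f "g t" "g t"]
    by (simp add: expect_def cdot_add_left cdot_add_right algebra_simps)
  also have "expect ?D (g t) = expect ?D g0"
    unfolding g by (rule expect_schroedinger_commuting[OF L])
      (simp add: matrix_eq matrix_vector_mul_assoc[symmetric] laplacian_vector
        matrix_vector_mult_minus_right)
  also have "2 * \<i> * expect ?D g0 = 2 * expect (matrix_scale \<i> ?D) g0"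
    by (simp add: expect_def cdot_def matrix_scale_def matrix_vector_mult_def
        sum_distrib_left sum_distrib_right mult_ac)
  finally have eq: "- \<i> * expect (?X ** ?L - ?L ** ?X) (g t) - 2 * expect (matrix_scale \<i> ?D) g0
      = \<i> * (cdot (?D *v g t) e - cdot e (?D *v g t))"
    by simp

  have "norm (g t) = 1"
    unfolding g using norm_schroedinger[OF L] assms(2) by simp
  with norm_matrix_vector_le_onorm[of ?D "g t"]
  have "norm (?D *v g t) * norm e \<le> onorm (\<lambda>x. ?D *v x) * \<epsilon>"
    \<comment> \<open>Since \<open>g t\<close> has norm 1, the operator norm bounds
      \<open>norm (?D *v g t)\<close> and is therefore nonnegative, as \<open>mult_mono\<close>
      requires.\<close>
    using e(2) by (intro mult_mono) (auto intro: order_trans[OF norm_ge_zero])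
  moreover have "cmod (cdot (?D *v g t) e - cdot e (?D *v g t)) \<le> 2 * (norm (?D *v g t) * norm e)"
    using norm_triangle_ineq4[of "cdot (?D *v g t) e" "cdot e (?D *v g t)"]
      cmod_cdot_le[of "?D *v g t" e] cmod_cdot_le[of e "?D *v g t"]
    by (simp add: mult.commute)
  ultimately have "cmod (\<i> * (cdot (?D *v g t) e - cdot e (?D *v g t)))
      \<le> 2 * \<epsilon> * onorm (\<lambda>x. ?D *v x)"
    by (simp add: norm_mult mult_ac)
  \<comment> \<open>\<open>deriv\<close> gives both differentiability and the value of
    \<open>vector_derivative\<close>.\<close>
  then show ?thesis
    using deriv eq by (auto simp: vector_derivative_at intro: differentiableI_vector)
qed

end
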